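(* Let $\gamma\in\mathbb{R}\setminus\{0\}$, $0<q<\infty$, $0<\eta\le1$, and $f\in C_c^\eta(\mathbb{R}^n)$. For every $x\in\mathbb{R}^n$, with $$E_x^{(0)}(f,\lambda,q,\gamma):=\{y\in\mathbb{R}^n:|f(x)-f(y)|>\lambda|x-y|^{\gamma/q}\},\qquad\lambda>0,$$ one has $$\lim_{\lambda\to0^+}\lambda\left(\int_{E_x^{(0)}(f,\lambda,q,\gamma)}|x-y|^{\gamma-n}\,dy\right)^{1/q}=\frac{|\mathbb S^{n-1}|^{1/q}}{\gamma^{1/q}}|f(x)|\quad\text{if }\gamma>0,$$ $$\lim_{\lambda\to\infty}\lambda\left(\int_{E_x^{(0)}(f,\lambda,q,\gamma)}|x-y|^{\gamma-n}\,dy\right)^{1/q}=\frac{|\mathbb S^{n-1}|^{1/q}}{(-\gamma)^{1/q}}|f(x)|\quad\text{if }\gamma<0.$$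
   Context: $C_c^\eta(\mathbb{R}^n)$ is the space of compactly supported functions that are Hölder continuous of exponent $\eta$ (Lipschitz if $\eta=1$). $|\mathbb S^{n-1}|$ is the surface measure of the unit sphere. *)

theory Defs
  imports "HOL-Analysis.Analysis"
begin

text \<open>
  The scalars range over a type of class \<open>real_normed_field\<close>, so that real-valued and
  complex-valued functions are both covered; \<open>norm\<close> is the absolute value there.
\<close>

definition holder_continuous ::
    "real \<Rightarrow> ('a::metric_space \<Rightarrow> 'b::metric_space) \<Rightarrow> bool" where
  "holder_continuous \<eta> f \<longleftrightarrow> (\<exists>C. \<forall>x y. dist (f x) (f y) \<le> C * dist x y powr \<eta>)"

definition Cc_holder ::
    "real \<Rightarrow> ('a::metric_space \<Rightarrow> 'b::real_normed_vector) set" where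
  "Cc_holder \<eta> = {f. holder_continuous \<eta> f \<and> compact (closure {x. f x \<noteq> 0})}"

text \<open>
  Surface measure on the unit sphere, the one occurring in the polar coordinates formula:
  the mass of \<open>A\<close> is the dimension times the volume of the cone over \<open>A\<close>.
\<close>

definition sphere_surface_measure :: "'a::euclidean_space set \<Rightarrow> real" where
  "sphere_surface_measure A =
     real DIM('a) * measure lborel {r *\<^sub>R \<theta> |r \<theta>. 0 < r \<and> r < 1 \<and> \<theta> \<in> A}"

text \<open>Real powers of positive order on \<open>[0, \<infinity>]\<close>, with \<open>\<infinity>\<close> to the power \<open>p\<close> being \<open>\<infinity>\<close>.\<close>

definition ennreal_powr :: "ennreal \<Rightarrow> real \<Rightarrow> ennreal" where
  "ennreal_powr a p = (if a = \<infinity> then \<infinity> else ennreal (enn2real a powr p))"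

text \<open>
  At \<open>y = x\<close> and \<open>\<gamma> < 0\<close> the convention \<open>0 powr a = 0\<close> is harmless: the left-hand side of the
  inequality vanishes there, so \<open>x\<close> itself is never a member.
\<close>

definition E0 ::
    "'a::real_normed_vector \<Rightarrow> ('a \<Rightarrow> 'b::real_normed_vector) \<Rightarrow> real \<Rightarrow> real \<Rightarrow> real \<Rightarrow> 'a set"
  where "E0 x f l q \<gamma> = {y. norm (f x - f y) > l * norm (x - y) powr (\<gamma> / q)}"

end

theory Submission
  imports Defs
begin

text \<open>
  Let \<open>f\<close> vanish outside \<open>cball x R\<close> and put \<open>\<rho> = (|f x| / \<lambda>) powr (q / \<gamma>)\<close>.  Outside that ball
  membership of \<open>y\<close> in \<open>E0\<close> only depends on \<open>|x - y|\<close>: it says \<open>|x - y| < \<rho>\<close> if \<open>\<gamma> > 0\<close> and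
  \<open>|x - y| > \<rho>\<close> if \<open>\<gamma> < 0\<close>.  The weight integrates over these radial regions explicitly, to a
  multiple of \<open>\<rho> powr \<gamma> = |f x| powr q / \<lambda> powr q\<close>.  If \<open>\<gamma> > 0\<close>, the ball contributes a bounded
  amount, which is negligible as \<open>\<lambda> \<rightarrow> 0\<close>; if \<open>\<gamma> < 0\<close>, boundedness of \<open>f\<close> keeps \<open>E0\<close> away from
  the ball for large \<open>\<lambda>\<close>.
\<close>

section \<open>Polar coordinates for radial integrands\<close>

text \<open>The cone over the whole sphere is the open unit ball without its centre, which is a null
  set.\<close>

lemma sphere_surface_measure_sphere:
  "sphere_surface_measure (sphere (0::'a::euclidean_space) 1) = real DIM('a) * unit_ball_vol (real DIM('a))"
proof -
  have "{r *\<^sub>R \<theta> |r \<theta>. 0 < r \<and> r < 1 \<and> \<theta> \<in> sphere (0::'a) 1} = ball 0 1 - {0}"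
  proof (intro set_eqI iffI)
    fix z :: 'a assume "z \<in> ball 0 1 - {0}"
    then have "z = norm z *\<^sub>R (z /\<^sub>R norm z) \<and> 0 < norm z \<and> norm z < 1 \<and> z /\<^sub>R norm z \<in> sphere 0 1"
      by auto
    then show "z \<in> {r *\<^sub>R \<theta> |r \<theta>. 0 < r \<and> r < 1 \<and> \<theta> \<in> sphere (0::'a) 1}" by blast
  qed auto
  moreover have "measure lborel (ball (0::'a) 1 - {0}) = measure lborel (ball (0::'a) 1)"
    by (rule measure_Diff_null_set) auto
  ultimately show ?thesis
    by (simp add: sphere_surface_measure_def content_ball)
qed

lemma sphere_surface_measure_sphere_nonneg:
  "0 \<le> sphere_surface_measure (sphere (0::'a::euclidean_space) 1)"
  by (simp add: sphere_surface_measure_def)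

text \<open>Polar coordinates, stated as a pushforward: the mass of \<open>{..a}\<close> is the
  volume of a ball of radius \<open>a\<close>, whose derivative in \<open>a\<close> is the density
  on the right. Such half-lines form an intersection-stable generator of the Borel sets, so
  agreement on them suffices.\<close>

lemma distr_norm_diff_lborel:
  fixes x :: "'a::euclidean_space"
  shows "distr lborel borel (\<lambda>y. norm (x - y)) =
    density lborel (\<lambda>r. ennreal (sphere_surface_measure (sphere (0::'a) 1) * r ^ (DIM('a) - 1))
      * indicator {0..} r)"
    (is "?M = density lborel ?g")
proof (rule measure_eqI_generator_eq)
  let ?n = "DIM('a)"
  let ?w = "unit_ball_vol (real ?n)"
  have M: "emeasure ?M {..a} = (if a < 0 then 0 else ennreal (?w * a ^ ?n))" for a
  proof -
    have "emeasure ?M {..a} = emeasure lborel ((\<lambda>y. norm (x - y)) -` {..a})"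
      by (subst emeasure_distr) auto
    also have "(\<lambda>y. norm (x - y)) -` {..a} = cball x a"
      by (auto simp: dist_norm)
    finally show ?thesis by (auto simp: emeasure_cball)
  qed
  show "Int_stable (range (\<lambda>a::real. {..a}))"
    by (auto simp: Int_stable_def)
  show "range (\<lambda>a::real. {..a}) \<subseteq> Pow UNIV" by simp
  show "sets ?M = sigma_sets UNIV (range (\<lambda>a::real. {..a}))"
    by (simp add: borel_eq_atMost)
  show "sets (density lborel ?g) = sigma_sets UNIV (range (\<lambda>a::real. {..a}))"
    by (simp add: borel_eq_atMost)
  show "range (\<lambda>i::nat. {..real i}) \<subseteq> range (\<lambda>a::real. {..a})" by auto
  show "(\<Union>i::nat. {..real i}) = UNIV" by (auto simp: real_arch_simple)
  show "emeasure ?M {..real i} \<noteq> \<infinity>" for i by (simp add: M)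
  fix X :: "real set" assume "X \<in> range (\<lambda>a. {..a})"
  then obtain a where X: "X = {..a}" by auto
  let ?s = "real ?n * ?w"
  have "emeasure (density lborel ?g) {..a}
      = (\<integral>\<^sup>+ r. ennreal (?s * r ^ (?n - 1)) * indicator {0..a} r \<partial>lborel)"
    by (subst emeasure_density)
      (auto intro!: nn_integral_cong simp: sphere_surface_measure_sphere split: split_indicator)
  also have "\<dots> = emeasure ?M {..a}"
  proof (cases "a < 0")
    case False
    \<comment> \<open>The antiderivative is the ball volume \<open>?w * r ^ ?n\<close>.\<close>
    have "(\<integral>\<^sup>+ r. ennreal (?s * r ^ (?n - 1)) * indicator {0..a} r \<partial>lborel)
        = ennreal (?w * a ^ ?n - ?w * 0 ^ ?n)"
      using False
      by (intro nn_integral_FTC_Icc) (auto intro!: derivative_eq_intros)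
    with False show ?thesis by (simp add: M)
  qed (simp add: M)
  finally show "emeasure ?M X = emeasure (density lborel ?g) X" by (simp add: X)
qed

text \<open>The Jacobian \<open>r ^ (n - 1)\<close> turns the weight of exponent
  \<open>g - n\<close> into \<open>r powr (g - 1)\<close>, so only a one-dimensional integral over
  the radii is left.\<close>

lemma nn_integral_norm_powr:
  fixes x :: "'a::euclidean_space"
  assumes [measurable]: "A \<in> sets borel" and "A \<subseteq> {0..}"
    and I: "((\<lambda>r. r powr (g - 1)) has_integral I) A"
  shows "(\<integral>\<^sup>+ y \<in> {y. norm (x - y) \<in> A}. ennreal (norm (x - y) powr (g - real DIM('a))) \<partial>lborel)
    = ennreal (sphere_surface_measure (sphere (0::'a) 1) * I)"
proof -
  let ?s = "sphere_surface_measure (sphere (0::'a) 1)"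
  let ?n = "DIM('a)"
  let ?h = "\<lambda>r. ennreal (r powr (g - real ?n)) * indicator A r"
  have "(\<integral>\<^sup>+ y \<in> {y. norm (x - y) \<in> A}. ennreal (norm (x - y) powr (g - real ?n)) \<partial>lborel)
      = (\<integral>\<^sup>+ y. ?h (norm (x - y)) \<partial>lborel)"
    by (auto intro!: nn_integral_cong split: split_indicator)
  also have "\<dots> = (\<integral>\<^sup>+ r. ?h r \<partial>distr lborel borel (\<lambda>y. norm (x - y)))"
    by (subst nn_integral_distr) auto
  also have "\<dots> = (\<integral>\<^sup>+ r. (ennreal (?s * r ^ (?n - 1)) * indicator {0..} r) * ?h r \<partial>lborel)"
    unfolding distr_norm_diff_lborel by (subst nn_integral_density) auto
  also have "\<dots> = (\<integral>\<^sup>+ r. ennreal ?s * (ennreal (r powr (g - 1)) * indicator A r) \<partial>lborel)"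
  proof (intro nn_integral_cong)
    fix r :: real
    \<comment> \<open>At \<open>r = 0\<close> both sides vanish because \<open>0 powr a = 0\<close>,
      even in dimension one, where \<open>0 ^ 0 = 1\<close>.\<close>
    have "r ^ (?n - 1) * r powr (g - real ?n) = r powr (g - 1)" if "0 \<le> r"
    proof (cases "r = 0")
      case False
      with that have "r ^ (?n - 1) = r powr real (?n - 1)"
        by (intro powr_realpow[symmetric]) simp
      then have "r ^ (?n - 1) * r powr (g - real ?n) = r powr (real (?n - 1) + (g - real ?n))"
        by (simp only: powr_add)
      also have "real (?n - 1) + (g - real ?n) = g - 1"
        by (simp add: of_nat_diff DIM_positive Suc_leI)
      finally show ?thesis .
    qed simp
    then show "(ennreal (?s * r ^ (?n - 1)) * indicator {0..} r) * ?h r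
        = ennreal ?s * (ennreal (r powr (g - 1)) * indicator A r)"
      using \<open>A \<subseteq> {0..}\<close> sphere_surface_measure_sphere_nonneg[where 'a='a]
      by (auto simp: ennreal_mult'[symmetric] mult.assoc split: split_indicator)
  qed
  also have "\<dots> = ennreal ?s * (\<integral>\<^sup>+ r. ennreal (r powr (g - 1)) * indicator A r \<partial>lborel)"
    by (rule nn_integral_cmult) auto
  also have "\<dots> = ennreal (?s * I)"
    by (subst nn_integral_has_integral_lebesgue'[OF _ I])
      (auto simp: ennreal_mult' sphere_surface_measure_sphere_nonneg)
  finally show ?thesis .
qed

section \<open>Integrals of powers over intervals of radii\<close>

lemma has_integral_powr_Ioo:
  fixes a b g :: real
  assumes "0 < a" "a \<le> b" "g \<noteq> 0"
  shows "((\<lambda>r. r powr (g - 1)) has_integral (b powr g - a powr g) / g) {a<..<b}"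
proof -
  have "((\<lambda>r. r powr (g - 1)) has_integral (b powr g / g - a powr g / g)) {a..b}"
    using assms
    by (intro fundamental_theorem_of_calculus)
      (auto intro!: derivative_eq_intros
        simp: has_real_derivative_iff_has_vector_derivative[symmetric])
  then show ?thesis
    by (simp add: has_integral_Icc_iff_Ioo diff_divide_distrib)
qed

lemma has_integral_powr_Ioi:
  fixes a g :: real
  assumes "0 < a" "g < 0"
  shows "((\<lambda>r. r powr (g - 1)) has_integral a powr g / - g) {a<..}"
proof -
  \<comment> \<open>The integral is first taken over the closed half-line, seen as a closure; the
    frontier point removed afterwards is negligible.\<close>
  have "((\<lambda>r. r powr (g - 1)) has_integral a powr g / - g) (closure {a<..})"
    using has_integral_powr_to_inf[of "g - 1" a] assms by simp
  moreover have "{a..} - {a<..} = {a}" by auto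
  ultimately show ?thesis
    by (subst (asm) has_integral_closure) (simp_all add: frontier_def interior_open \<open>{a..} - {a<..} = {a}\<close>)
qed

section \<open>From bounds on the integral to the limit of its root\<close>

text \<open>Moves all estimates to the \<open>q\<close>-th power, where the measure is additive and
  no root occurs; continuity of the root then carries the limit over.\<close>

lemma tendsto_scaled_ennreal_powr:
  fixes I :: "real \<Rightarrow> ennreal" and q :: real
  assumes "0 < q"
    and pos: "\<forall>\<^sub>F l in F. 0 < l"
    and fin: "\<forall>\<^sub>F l in F. I l < \<infinity>"
    and lo: "\<forall>\<^sub>F l in F. a l \<le> l powr q * enn2real (I l)"
    and up: "\<forall>\<^sub>F l in F. l powr q * enn2real (I l) \<le> b l"
    and lims: "(a \<longlongrightarrow> L) F" "(b \<longlongrightarrow> L) F"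
  shows "((\<lambda>l. ennreal l * ennreal_powr (I l) (1 / q)) \<longlongrightarrow> ennreal (L powr (1 / q))) F"
proof -
  have lim: "((\<lambda>l. l powr q * enn2real (I l)) \<longlongrightarrow> L) F"
    by (rule tendsto_sandwich[OF lo up lims])
  have "((\<lambda>l. (l powr q * enn2real (I l)) powr (1 / q)) \<longlongrightarrow> L powr (1 / q)) F"
    \<comment> \<open>The case \<open>L = 0\<close> is covered since the exponent is positive and
      the base nonnegative.\<close>
    using \<open>0 < q\<close> by (intro tendsto_powr'[OF lim tendsto_const]) auto
  then have "((\<lambda>l. ennreal ((l powr q * enn2real (I l)) powr (1 / q)))
      \<longlongrightarrow> ennreal (L powr (1 / q))) F"
    by (rule tendsto_ennrealI)
  moreover have "\<forall>\<^sub>F l in F. ennreal ((l powr q * enn2real (I l)) powr (1 / q))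
      = ennreal l * ennreal_powr (I l) (1 / q)"
    using pos fin
  proof eventually_elim
    case (elim l)
    then show ?case
      using \<open>0 < q\<close>
      by (auto simp: ennreal_powr_def powr_mult powr_powr ennreal_mult')
  qed
  ultimately show ?thesis
    by (rule Lim_transform_eventually)
qed

section \<open>Support and boundedness of \<open>f\<close>\<close>

lemma Cc_holder_vanishes_outside:
  fixes f :: "'a::real_normed_vector \<Rightarrow> 'b::real_normed_vector"
  assumes "f \<in> Cc_holder \<eta>"
  obtains R where "0 < R" "\<And>y. R < norm (x - y) \<Longrightarrow> f y = 0"
proof -
  have "bounded {y. f y \<noteq> 0}"
    using assms by (intro bounded_subset[OF compact_imp_bounded closure_subset]) (simp add: Cc_holder_def)
  then obtain e where "\<And>y. f y \<noteq> 0 \<Longrightarrow> dist x y \<le> e"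
    by (auto simp: bounded_any_center[of _ x])
  then show thesis
    by (intro that[of "max 1 e"]) (fastforce simp: dist_norm)+
qed

lemma Cc_holder_diff_bounded:
  fixes f :: "'a::real_normed_vector \<Rightarrow> 'b::real_normed_vector"
  assumes "f \<in> Cc_holder \<eta>" "0 < \<eta>"
  obtains B where "0 < B" "\<And>y. norm (f x - f y) \<le> B"
proof -
  obtain C where C: "\<And>u v. dist (f u) (f v) \<le> C * dist u v powr \<eta>"
    using assms by (auto simp: Cc_holder_def holder_continuous_def)
  obtain R where R: "0 < R" "\<And>y. R < norm (x - y) \<Longrightarrow> f y = 0"
    using Cc_holder_vanishes_outside[OF assms(1), of x] by blast
  \<comment> \<open>The Hoelder constant may be negative, hence \<open>\<bar>C\<bar>\<close>; the
    summand \<open>1\<close> makes the bound strictly positive.\<close>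
  have "norm (f x - f y) \<le> max (\<bar>C\<bar> * R powr \<eta>) (norm (f x)) + 1" for y
  proof (cases "norm (x - y) \<le> R")
    case True
    have "norm (f x - f y) \<le> C * norm (x - y) powr \<eta>"
      using C[of x y] by (simp add: dist_norm)
    also have "\<dots> \<le> \<bar>C\<bar> * norm (x - y) powr \<eta>"
      by (intro mult_right_mono) auto
    also have "\<dots> \<le> \<bar>C\<bar> * R powr \<eta>"
      using True \<open>0 < \<eta>\<close> by (intro mult_left_mono powr_mono2) auto
    finally show ?thesis by linarith
  next
    case False
    then have "f y = 0" using R(2) by simp
    then show ?thesis by simp
  qed
  moreover have "0 < max (\<bar>C\<bar> * R powr \<eta>) (norm (f x)) + 1"
    by (smt (verit) norm_ge_zero)
  ultimately show thesis using that by blast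
qed

section \<open>Solving the inequality that defines \<open>E0\<close> for the radius\<close>

lemma mult_powr_less_iff_pos:
  fixes l r c g q :: real
  assumes "0 < g" "0 < q" "0 < l" "0 \<le> r" "0 \<le> c"
  shows "l * r powr (g / q) < c \<longleftrightarrow> r < (c / l) powr (q / g)"
proof -
  have "l * r powr (g / q) < c \<longleftrightarrow> r powr (g / q) < c / l"
    using assms by (simp add: field_simps)
  also have "\<dots> \<longleftrightarrow> (r powr (g / q)) powr (q / g) < (c / l) powr (q / g)"
    using assms powr_less_cancel2[of "q / g" "r powr (g / q)" "c / l"]
    by (smt (verit) divide_nonneg_pos divide_pos_pos powr_ge_zero powr_less_mono2 powr_mono2)
  also have "(r powr (g / q)) powr (q / g) = r"
    using assms by (simp add: powr_powr)
  finally show ?thesis .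
qed

text \<open>Taking logarithms leaves a multiplication by the negative number \<open>g / q\<close>,
  which reverses the order. For \<open>c = 0\<close> the equivalence would fail: the left side is
  false, but \<open>0 powr a = 0\<close> makes the right side true.\<close>

lemma mult_powr_less_iff_neg:
  fixes l r c g q :: real
  assumes "g < 0" "0 < q" "0 < l" "0 < r" "0 < c"
  shows "l * r powr (g / q) < c \<longleftrightarrow> (c / l) powr (q / g) < r"
proof -
  have "l * r powr (g / q) < c \<longleftrightarrow> r powr (g / q) < c / l"
    using assms by (simp add: field_simps)
  also have "\<dots> \<longleftrightarrow> ln (r powr (g / q)) < ln (c / l)"
    using assms by (subst ln_less_cancel_iff) auto
  also have "\<dots> \<longleftrightarrow> q / g * ln (c / l) < ln r"
    using assms by (simp add: ln_powr field_simps)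
  also have "\<dots> \<longleftrightarrow> ln ((c / l) powr (q / g)) < ln r"
    using assms by (simp add: ln_powr)
  also have "\<dots> \<longleftrightarrow> (c / l) powr (q / g) < r"
    using assms by (subst ln_less_cancel_iff) auto
  finally show ?thesis .
qed

section \<open>The limit for positive exponent\<close>

text \<open>\<open>E0\<close> lies in the ball of radius \<open>max R (\<rho> l)\<close> and
  contains the shell between the radii \<open>R\<close> and \<open>\<rho> l\<close>. After scaling
  by \<open>l powr q\<close>, the weights of both tend to the same limit.\<close>

lemma E0_limit_pos:
  fixes f :: "'a::euclidean_space \<Rightarrow> 'b::real_normed_vector"
  assumes "0 < g" "0 < q" "0 < R" and R: "\<And>y. R < norm (x - y) \<Longrightarrow> f y = 0"
  defines "s \<equiv> sphere_surface_measure (sphere (0::'a) 1)"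
  shows "((\<lambda>l. ennreal l * ennreal_powr
      (\<integral>\<^sup>+ y \<in> E0 x f l q g. ennreal (norm (x - y) powr (g - real DIM('a))) \<partial>lborel) (1 / q))
    \<longlongrightarrow> ennreal ((s * norm (f x) powr q / g) powr (1 / q))) (at_right 0)"
proof -
  define J where "J A = (\<integral>\<^sup>+ y \<in> A. ennreal (norm (x - y) powr (g - real DIM('a))) \<partial>lborel)" for A
  define \<rho> where "\<rho> l = (norm (f x) / l) powr (q / g)" for l
  have J_mono: "J A \<le> J B" if "A \<subseteq> B" for A B
    unfolding J_def using that by (intro nn_integral_mono mult_left_mono) (auto split: split_indicator)
  have s0: "0 \<le> s" unfolding s_def by (rule sphere_surface_measure_sphere_nonneg)
  have \<rho>0: "0 \<le> \<rho> l" for l by (simp add: \<rho>_def)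
  have \<rho>g: "l powr q * \<rho> l powr g = norm (f x) powr q" if "0 < l" for l
    using that assms by (simp add: \<rho>_def powr_powr powr_divide)
  have iff: "y \<in> E0 x f l q g \<longleftrightarrow> norm (x - y) < \<rho> l" if "0 < l" "R < norm (x - y)" for l y
    using that R[of y] assms mult_powr_less_iff_pos[of g q l "norm (x - y)" "norm (f x)"]
    by (simp add: E0_def \<rho>_def)
  have up: "J (E0 x f l q g) \<le> ennreal (s * (max R (\<rho> l) powr g / g))" if "0 < l" for l
  proof -
    have "J (E0 x f l q g) \<le> J {y. norm (x - y) \<in> {0..max R (\<rho> l)}}"
      using iff[OF that] by (intro J_mono) force
    also have "\<dots> = ennreal (s * (max R (\<rho> l) powr g / g))"
      unfolding J_def s_def
      \<comment> \<open>Integrability down to radius \<open>0\<close> holds because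
        \<open>g - 1 > -1\<close>.\<close>
      using has_integral_powr_from_0[of "g - 1" "max R (\<rho> l)"] assms
      by (intro nn_integral_norm_powr) auto
    finally show ?thesis .
  qed
  have lo: "ennreal (s * ((\<rho> l powr g - R powr g) / g)) \<le> J (E0 x f l q g)" if "0 < l" for l
  proof (cases "R \<le> \<rho> l")
    case True
    have "ennreal (s * ((\<rho> l powr g - R powr g) / g)) = J {y. norm (x - y) \<in> {R<..<\<rho> l}}"
      unfolding J_def s_def using assms True
      by (intro nn_integral_norm_powr[symmetric] has_integral_powr_Ioo) auto
    also have "\<dots> \<le> J (E0 x f l q g)"
      using iff[OF that] by (intro J_mono) auto
    finally show ?thesis .
  next
    case False
    \<comment> \<open>The shell is empty here; the bound is nonpositive and \<open>ennreal\<close>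
      truncates it to \<open>0\<close>.\<close>
    then have "\<rho> l powr g \<le> R powr g"
      using assms \<rho>0 by (intro powr_mono2) auto
    then have "s * ((\<rho> l powr g - R powr g) / g) \<le> 0"
      using s0 assms by (intro mult_nonneg_nonpos) (auto simp: divide_le_0_iff)
    then show ?thesis by (simp add: ennreal_neg)
  qed
  have ev: "\<forall>\<^sub>F l::real in at_right 0. 0 < l"
    by (simp add: eventually_at_right_less)
  have fin: "J (E0 x f l q g) < \<infinity>" if "0 < l" for l
    using up[OF that] by (simp add: le_less_trans)
  have lpow: "((\<lambda>l. l powr q) \<longlongrightarrow> 0) (at_right 0)"
    using \<open>0 < q\<close> by (auto intro!: tendsto_eq_intros eventually_mono[OF ev])
  \<comment> \<open>The factor \<open>0\<close> stays unevaluated so that the target has the shape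
    the limit rules produce.\<close>
  have lim_lo: "((\<lambda>l. s * ((norm (f x) powr q - l powr q * R powr g) / g))
      \<longlongrightarrow> s * ((norm (f x) powr q - 0 * R powr g) / g)) (at_right 0)"
    using \<open>0 < g\<close> by (intro lpow tendsto_intros) simp
  have lim_up: "((\<lambda>l. s * (max (l powr q * R powr g) (norm (f x) powr q) / g))
      \<longlongrightarrow> s * (max (0 * R powr g) (norm (f x) powr q) / g)) (at_right 0)"
    using \<open>0 < g\<close> by (intro lpow tendsto_intros) simp
  show ?thesis
    unfolding J_def[symmetric]
  proof (rule tendsto_scaled_ennreal_powr[where
        a = "\<lambda>l. s * ((norm (f x) powr q - l powr q * R powr g) / g)" and
        b = "\<lambda>l. s * (max (l powr q * R powr g) (norm (f x) powr q) / g)"])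
    show "0 < q" by fact
    show "\<forall>\<^sub>F l::real in at_right 0. 0 < l" by (rule ev)
    show "\<forall>\<^sub>F l in at_right 0. J (E0 x f l q g) < \<infinity>"
      using ev by eventually_elim (rule fin)
    show "\<forall>\<^sub>F l in at_right 0. s * ((norm (f x) powr q - l powr q * R powr g) / g)
        \<le> l powr q * enn2real (J (E0 x f l q g))"
      using ev
    proof eventually_elim
      case (elim l)
      have "s * ((norm (f x) powr q - l powr q * R powr g) / g)
          = l powr q * (s * ((\<rho> l powr g - R powr g) / g))"
        by (simp add: \<rho>g[OF elim, symmetric] algebra_simps diff_divide_distrib)
      also have "s * ((\<rho> l powr g - R powr g) / g) \<le> enn2real (J (E0 x f l q g))"
        using lo[OF elim] fin[OF elim]
        by (cases "J (E0 x f l q g)") (auto simp: ennreal_le_iff2)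
      finally show ?case by (simp add: mult_left_mono)
    qed
    show "\<forall>\<^sub>F l in at_right 0. l powr q * enn2real (J (E0 x f l q g))
        \<le> s * (max (l powr q * R powr g) (norm (f x) powr q) / g)"
      using ev
    proof eventually_elim
      case (elim l)
      have "enn2real (J (E0 x f l q g)) \<le> s * (max R (\<rho> l) powr g / g)"
        using up[OF elim] s0 assms by (intro enn2real_leI) auto
      \<comment> \<open>Monotonicity of \<open>powr g\<close> on nonnegative numbers lets it pass
        through \<open>max\<close>.\<close>
      also have "max R (\<rho> l) powr g = max (R powr g) (\<rho> l powr g)"
        using powr_mono2[of g R "\<rho> l"] powr_mono2[of g "\<rho> l" R] \<rho>0[of l] \<open>0 < g\<close> \<open>0 < R\<close>
        by (cases "R \<le> \<rho> l") (simp_all add: max_absorb1 max_absorb2)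
      finally have "l powr q * enn2real (J (E0 x f l q g))
          \<le> l powr q * (s * (max (R powr g) (\<rho> l powr g) / g))"
        by (rule mult_left_mono) simp
      also have "\<dots> = s * (max (l powr q * R powr g) (l powr q * \<rho> l powr g) / g)"
        by (cases "R powr g \<le> \<rho> l powr g")
          (simp_all add: max_absorb1 max_absorb2 mult_left_mono)
      finally show ?case by (simp add: \<rho>g[OF elim])
    qed
    show "((\<lambda>l. s * ((norm (f x) powr q - l powr q * R powr g) / g))
        \<longlongrightarrow> s * norm (f x) powr q / g) (at_right 0)"
      using lim_lo by simp
    show "((\<lambda>l. s * (max (l powr q * R powr g) (norm (f x) powr q) / g))
        \<longlongrightarrow> s * norm (f x) powr q / g) (at_right 0)"
      using lim_up by simp
  qed
qed

section \<open>The limit for negative exponent\<close>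

text \<open>From a threshold \<open>K\<close> on, \<open>E0\<close> is exactly the exterior of a
  ball, or empty if \<open>f x = 0\<close>. The scaled quantity is then constant in
  \<open>l\<close>, so both sandwich bounds are its value.\<close>

lemma E0_limit_neg:
  fixes f :: "'a::euclidean_space \<Rightarrow> 'b::real_normed_vector"
  assumes "g < 0" "0 < q" "0 < R" and R: "\<And>y. R < norm (x - y) \<Longrightarrow> f y = 0"
    and "0 < B" and B: "\<And>y. norm (f x - f y) \<le> B"
  defines "s \<equiv> sphere_surface_measure (sphere (0::'a) 1)"
  shows "((\<lambda>l. ennreal l * ennreal_powr
      (\<integral>\<^sup>+ y \<in> E0 x f l q g. ennreal (norm (x - y) powr (g - real DIM('a))) \<partial>lborel) (1 / q))
    \<longlongrightarrow> ennreal ((s * norm (f x) powr q / - g) powr (1 / q))) at_top"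
proof -
  define J where "J A = (\<integral>\<^sup>+ y \<in> A. ennreal (norm (x - y) powr (g - real DIM('a))) \<partial>lborel)" for A
  define \<rho> where "\<rho> l = (norm (f x) / l) powr (q / g)" for l
  have s0: "0 \<le> s" unfolding s_def by (rule sphere_surface_measure_sphere_nonneg)
  \<comment> \<open>For \<open>y \<noteq> x\<close> within distance \<open>R\<close>, the negative
    exponent gives \<open>l * norm (x - y) powr (g / q) \<ge> K * R powr (g / q) = B\<close> once
    \<open>l \<ge> K\<close>, which rules out membership in \<open>E0\<close>.\<close>
  define K where "K = B / R powr (g / q)"
  have "0 < K" using assms by (simp add: K_def)
  have far: "R < norm (x - y)" if "K \<le> l" "y \<in> E0 x f l q g" for l y
  proof (rule ccontr)
    assume near: "\<not> R < norm (x - y)"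
    \<comment> \<open>Needed first: \<open>0 powr a = 0\<close> breaks antitonicity at radius
      \<open>0\<close>.\<close>
    have "x \<noteq> y" using that by (auto simp: E0_def)
    then have "R powr (g / q) \<le> norm (x - y) powr (g / q)"
      using near assms by (intro powr_mono2') (auto simp: divide_nonpos_pos)
    then have "K * R powr (g / q) \<le> l * norm (x - y) powr (g / q)"
      using \<open>0 < K\<close> that by (intro mult_mono) auto
    moreover have "K * R powr (g / q) = B" using assms by (simp add: K_def)
    ultimately show False using that B[of y] by (simp add: E0_def)
  qed
  have J: "J (E0 x f l q g) = ennreal (s * (norm (f x) powr q / l powr q / - g))"
    if l: "K \<le> l" for l
  proof (cases "f x = 0")
    \<comment> \<open>Treated apart because \<open>\<rho> l\<close> is \<open>0\<close> here,
      although the appropriate radius is infinite. Points of \<open>E0\<close> would lie where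
      \<open>f\<close> vanishes, making the left side of the inequality \<open>0\<close>.\<close>
    case True
    have "E0 x f l q g = {}"
    proof -
      have False if "y \<in> E0 x f l q g" for y
        using R[OF far[OF l that]] that True l \<open>0 < K\<close> by (simp add: E0_def mult_less_0_iff)
      then show ?thesis by blast
    qed
    then show ?thesis by (simp add: J_def True)
  next
    case False
    have "0 < l" using l \<open>0 < K\<close> by simp
    have "0 < \<rho> l" using False \<open>0 < l\<close> by (simp add: \<rho>_def)
    \<comment> \<open>This puts all points beyond radius \<open>\<rho> l\<close> outside the support
      ball. A point at distance \<open>R + 1\<close>, where \<open>f\<close> vanishes, gives
      \<open>norm (f x) \<le> B\<close>; hence radius \<open>R\<close> fails the strict
      inequality.\<close>
    have "R \<le> \<rho> l"
    proof -
      have "norm (f x) \<le> B"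
      proof -
        obtain b :: 'a where b: "norm b = R + 1"
          using vector_choose_size[of "R + 1"] \<open>0 < R\<close> by auto
        then show ?thesis using B[of "x - b"] R[of "x - b"] by simp
      qed
      also have "B = K * R powr (g / q)" using assms by (simp add: K_def)
      also have "\<dots> \<le> l * R powr (g / q)" using l by (simp add: mult_right_mono)
      finally show ?thesis
        using mult_powr_less_iff_neg[of g q l R "norm (f x)"] assms \<open>0 < l\<close> False
        by (simp add: \<rho>_def not_less[symmetric])
    qed
    have "E0 x f l q g = {y. norm (x - y) \<in> {\<rho> l<..}}"
    proof -
      have iff: "y \<in> E0 x f l q g \<longleftrightarrow> \<rho> l < norm (x - y)" if "R < norm (x - y)" for y
        using that R[of y] \<open>g < 0\<close> \<open>0 < q\<close> \<open>0 < R\<close> \<open>0 < l\<close> False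
          mult_powr_less_iff_neg[of g q l "norm (x - y)" "norm (f x)"] less_trans[of 0 R "norm (x - y)"]
        by (simp add: E0_def \<rho>_def)
      show ?thesis
        using iff far[OF l] \<open>R \<le> \<rho> l\<close> by force
    qed
    then have "J (E0 x f l q g) = ennreal (s * (\<rho> l powr g / - g))"
      unfolding J_def s_def using \<open>0 < \<rho> l\<close> \<open>g < 0\<close>
      by (simp only:) (intro nn_integral_norm_powr has_integral_powr_Ioi, auto)
    moreover have "\<rho> l powr g = norm (f x) powr q / l powr q"
      using assms \<open>0 < l\<close> by (simp add: \<rho>_def powr_powr powr_divide)
    ultimately show ?thesis by simp
  qed
  have ev: "\<forall>\<^sub>F l in at_top. K \<le> l" by (rule eventually_ge_at_top)
  have eq: "l powr q * enn2real (J (E0 x f l q g)) = s * norm (f x) powr q / - g" if "K \<le> l" for l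
  proof -
    have "0 \<le> s * (norm (f x) powr q / l powr q / - g)"
      using s0 \<open>g < 0\<close> by (intro mult_nonneg_nonneg divide_nonneg_nonneg) auto
    moreover have "0 < l" using that \<open>0 < K\<close> by simp
    ultimately show ?thesis using that by (simp add: J)
  qed
  show ?thesis
    unfolding J_def[symmetric]
  proof (rule tendsto_scaled_ennreal_powr[OF \<open>0 < q\<close> eventually_gt_at_top _ _ _ tendsto_const tendsto_const])
    show "\<forall>\<^sub>F l in at_top. J (E0 x f l q g) < \<infinity>"
      using ev by eventually_elim (simp add: J)
    show "\<forall>\<^sub>F l in at_top. s * norm (f x) powr q / - g \<le> l powr q * enn2real (J (E0 x f l q g))"
      using ev by eventually_elim (simp only: eq)
    show "\<forall>\<^sub>F l in at_top. l powr q * enn2real (J (E0 x f l q g)) \<le> s * norm (f x) powr q / - g"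
      using ev by eventually_elim (simp only: eq)
  qed
qed

section \<open>Both limits with the constants in separated form\<close>

theorem theorem3p6:
  fixes \<gamma> q \<eta> :: real
    and f :: "real ^ 'n \<Rightarrow> 'b::real_normed_field"
    and x :: "real ^ 'n"
  assumes "\<gamma> \<noteq> 0" and "0 < q" and "0 < \<eta>" and "\<eta> \<le> 1"
    and "f \<in> Cc_holder \<eta>"
  shows "(\<gamma> > 0 \<longrightarrow>
      ((\<lambda>l. ennreal l * ennreal_powr
          (\<integral>\<^sup>+ y \<in> E0 x f l q \<gamma>. ennreal (norm (x - y) powr (\<gamma> - real CARD('n))) \<partial>lborel) (1 / q))
        \<longlongrightarrow> ennreal (sphere_surface_measure (sphere (0 :: real ^ 'n) 1) powr (1 / q)
              / \<gamma> powr (1 / q) * norm (f x))) (at_right 0)) \<and>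
    (\<gamma> < 0 \<longrightarrow>
      ((\<lambda>l. ennreal l * ennreal_powr
          (\<integral>\<^sup>+ y \<in> E0 x f l q \<gamma>. ennreal (norm (x - y) powr (\<gamma> - real CARD('n))) \<partial>lborel) (1 / q))
        \<longlongrightarrow> ennreal (sphere_surface_measure (sphere (0 :: real ^ 'n) 1) powr (1 / q)
              / (- \<gamma>) powr (1 / q) * norm (f x))) at_top)"
proof -
  let ?s = "sphere_surface_measure (sphere (0 :: real ^ 'n) 1)"
  obtain R where R: "0 < R" "\<And>y. R < norm (x - y) \<Longrightarrow> f y = 0"
    using Cc_holder_vanishes_outside[OF assms(5), of x] by blast
  obtain B where B: "0 < B" "\<And>y. norm (f x - f y) \<le> B"
    using Cc_holder_diff_bounded[OF assms(5) \<open>0 < \<eta>\<close>, of x] by blast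
  \<comment> \<open>Used with \<open>c = \<gamma>\<close> or \<open>c = - \<gamma>\<close>,
    whichever is positive.\<close>
  have root: "(?s * norm (f x) powr q / c) powr (1 / q) = ?s powr (1 / q) / c powr (1 / q) * norm (f x)"
    if "0 < c" for c
    using that \<open>0 < q\<close> sphere_surface_measure_sphere_nonneg[where 'a="real ^ 'n"]
    by (simp add: powr_divide powr_mult powr_powr)
  show ?thesis
    using E0_limit_pos[of \<gamma> q R x f] E0_limit_neg[of \<gamma> q R x f B] R B \<open>0 < q\<close> root[of \<gamma>] root[of "- \<gamma>"]
    by simp
qed

end
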